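(* Let $\varrho^{B}$ be a state on $\mathbb{C}^2\otimes\mathbb{C}^2$ that is diagonal in a maximally entangled basis. Then $$\mathcal{M}(\varrho^{B})=1-S(\varrho^{B}).$$
   Context: A state is a density matrix; $S(\varrho)=-\mathrm{Tr}\,\varrho\log_2\varrho$ is the von Neumann entropy. A maximally entangled basis is an orthonormal basis of $\mathbb{C}^2\otimes\mathbb{C}^2$ all of whose vectors are maximally entangled (both Schmidt coefficients equal to $1/\sqrt 2$). $\mathcal{PS}$ denotes the set of product states $\varrho_A\otimes\varrho_B$. A von Neumann measurement $\mathcal{P}=\{P_i\}$ is a complete family of mutually orthogonal rank-one projectors on $\mathbb{C}^2\otimes\mathbb{C}^2$ (not necessarily of product form) summing to the identity. The Klein entropy is $H(\varrho,\mathcal{P})=-\sum_i p_i\log_2 p_i$ with $p_i=\mathrm{Tr}(\varrho P_i)$ and $0\log_2 0=0$. The entropic entanglement parameter is $$\mathcal{M}(\varrho)=\sup_{\mathcal{P}}\Big(\inf_{\delta\in\mathcal{PS}}H(\delta,\mathcal{P})-H(\varrho,\mathcal{P})\Big),$$ the supremum being over all von Neumann measurements. *)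

theory Defs
  imports "HOL-Analysis.Analysis"
begin

text \<open>
  The space \<open>\<complex>\<^sup>2 \<otimes> \<complex>\<^sup>2\<close> is \<open>complex^(2 \<times> 2)\<close>: coordinate \<open>(i, j)\<close> refers to the
  product vector \<open>e\<^sub>i \<otimes> e\<^sub>j\<close>. The notions that make sense in every finite dimension are
  defined over an arbitrary finite index type.
\<close>

type_synonym two_qubit_vec = "complex^(2 \<times> 2)"
type_synonym two_qubit_op = "complex^(2 \<times> 2)^(2 \<times> 2)"


subsection \<open>Linear algebra over the complex numbers\<close>

definition cinner :: "complex^'n \<Rightarrow> complex^'n \<Rightarrow> complex" where
  "cinner x y = (\<Sum>i\<in>UNIV. cnj (x $ i) * y $ i)"

definition dagger :: "complex^'n^'n \<Rightarrow> complex^'n^'n" where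
  "dagger A = (\<chi> i j. cnj (A $ j $ i))"

definition hermitian :: "complex^'n^'n \<Rightarrow> bool" where
  "hermitian A \<longleftrightarrow> dagger A = A"

definition unitary :: "complex^'n^'n \<Rightarrow> bool" where
  "unitary U \<longleftrightarrow> U ** dagger U = mat 1 \<and> dagger U ** U = mat 1"

definition real_diag :: "('n \<Rightarrow> real) \<Rightarrow> complex^'n^'n" where
  "real_diag d = (\<chi> i j. if i = j then complex_of_real (d i) else 0)"

text \<open>
  Functional calculus: if \<open>A = U diag(d) U\<^sup>\<dagger>\<close> with \<open>U\<close> unitary and \<open>d\<close> real, then
  \<open>f(A) = U diag(f \<circ> d) U\<^sup>\<dagger>\<close>. By \<open>hermitian_fun_eq\<close> below the result is
  independent of the diagonalisation. It is meant for Hermitian \<open>A\<close> only.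
\<close>

definition hermitian_fun :: "(real \<Rightarrow> real) \<Rightarrow> complex^'n^'n \<Rightarrow> complex^'n^'n" where
  "hermitian_fun f A =
     (THE B. \<exists>U d. unitary U \<and> A = U ** real_diag d ** dagger U
                 \<and> B = U ** real_diag (f \<circ> d) ** dagger U)"

definition tensor_vec :: "complex^'a \<Rightarrow> complex^'b \<Rightarrow> complex^('a \<times> 'b)" where
  "tensor_vec x y = (\<chi> p. x $ fst p * y $ snd p)"

definition tensor_op ::
  "complex^'a^'a \<Rightarrow> complex^'b^'b \<Rightarrow> complex^('a \<times> 'b)^('a \<times> 'b)" where
  "tensor_op A B = (\<chi> p q. A $ fst p $ fst q * B $ snd p $ snd q)"

definition orthonormal :: "(complex^'n) set \<Rightarrow> bool" where
  "orthonormal S \<longleftrightarrow> (\<forall>x\<in>S. \<forall>y\<in>S. cinner x y = (if x = y then 1 else 0))"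

definition orthonormal_basis :: "(complex^'n) set \<Rightarrow> bool" where
  "orthonormal_basis S \<longleftrightarrow> orthonormal S \<and> vec.span S = UNIV"

definition diagonal_in :: "(complex^'n) set \<Rightarrow> complex^'n^'n \<Rightarrow> bool" where
  "diagonal_in S A \<longleftrightarrow> (\<forall>x\<in>S. \<forall>y\<in>S. x \<noteq> y \<longrightarrow> cinner x (A *v y) = 0)"


subsection \<open>States and entropy\<close>

definition state :: "complex^'n^'n \<Rightarrow> bool" where
  "state \<rho> \<longleftrightarrow> hermitian \<rho> \<and> (\<forall>v. 0 \<le> Re (cinner v (\<rho> *v v))) \<and> trace \<rho> = 1"

text \<open>
  In HOL \<open>log 2 0 = 0\<close>; hence zero eigenvalues contribute \<open>0\<close> here, and \<open>x * log 2 x\<close>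
  follows the convention \<open>0 log\<^sub>2 0 = 0\<close>. Where \<open>Re\<close> is applied to a trace below,
  the trace is real.
\<close>

definition von_neumann_entropy :: "complex^'n^'n \<Rightarrow> real" where
  "von_neumann_entropy \<rho> = - Re (trace (\<rho> ** hermitian_fun (log 2) \<rho>))"

definition product_states :: "two_qubit_op set" where
  "product_states =
     {tensor_op \<rho>A \<rho>B | (\<rho>A :: complex^2^2) (\<rho>B :: complex^2^2). state \<rho>A \<and> state \<rho>B}"

text \<open>The orthonormal vectors \<open>a i\<close>, \<open>b i\<close> form a Schmidt decomposition of \<open>\<psi>\<close>.\<close>

definition maximally_entangled :: "two_qubit_vec \<Rightarrow> bool" where
  "maximally_entangled \<psi> \<longleftrightarrow>
     (\<exists>(a :: 2 \<Rightarrow> complex^2) (b :: 2 \<Rightarrow> complex^2).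
        (\<forall>i j. cinner (a i) (a j) = (if i = j then 1 else 0)) \<and>
        (\<forall>i j. cinner (b i) (b j) = (if i = j then 1 else 0)) \<and>
        \<psi> = (\<Sum>i\<in>UNIV. complex_of_real (1 / sqrt 2) *s tensor_vec (a i) (b i)))"

definition maximally_entangled_basis :: "two_qubit_vec set \<Rightarrow> bool" where
  "maximally_entangled_basis S \<longleftrightarrow> orthonormal_basis S \<and> (\<forall>\<psi>\<in>S. maximally_entangled \<psi>)"


subsection \<open>Measurements and the entanglement parameter\<close>

definition rank_one_projector :: "complex^'n^'n \<Rightarrow> bool" where
  "rank_one_projector P \<longleftrightarrow> hermitian P \<and> P ** P = P \<and> rank P = 1"

text \<open>
  A family of mutually orthogonal nonzero projectors has no repetitions, so it can be given
  as a set.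
\<close>

definition von_neumann_measurement :: "(complex^'n^'n) set \<Rightarrow> bool" where
  "von_neumann_measurement M \<longleftrightarrow>
     finite M \<and> (\<forall>P\<in>M. rank_one_projector P) \<and>
     (\<forall>P\<in>M. \<forall>Q\<in>M. P \<noteq> Q \<longrightarrow> P ** Q = 0) \<and> (\<Sum>P\<in>M. P) = mat 1"

definition klein_entropy :: "complex^'n^'n \<Rightarrow> (complex^'n^'n) set \<Rightarrow> real" where
  "klein_entropy \<rho> M =
     - (\<Sum>P\<in>M. Re (trace (\<rho> ** P)) * log 2 (Re (trace (\<rho> ** P))))"

text \<open>
  For states and measurements \<open>0 \<le> klein_entropy \<rho> M \<le> 2\<close> in dimension four, so the
  real-valued infimum and supremum range over bounded nonempty sets.
\<close>

definition entropic_entanglement :: "two_qubit_op \<Rightarrow> real" where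
  "entropic_entanglement \<rho> =
     (SUP M\<in>{M. von_neumann_measurement M}.
        (INF \<delta>\<in>product_states. klein_entropy \<delta> M) - klein_entropy \<rho> M)"


subsection \<open>The functional calculus is well defined\<close>

lemma real_diag_mult_left: "(real_diag d ** A) $ i $ j = of_real (d i) * A $ i $ j"
  by (simp add: matrix_matrix_mult_def real_diag_def if_distribR
      if_distrib[of "\<lambda>x. x * _"] cong: if_cong)

lemma real_diag_mult_right: "(A ** real_diag d) $ i $ j = A $ i $ j * of_real (d j)"
  by (simp add: matrix_matrix_mult_def real_diag_def
      if_distrib[of "\<lambda>x. _ * x"] cong: if_cong)

lemma hermitian_fun_unique:
  assumes U: "unitary U" and V: "unitary V"
    and eq: "U ** real_diag d ** dagger U = V ** real_diag e ** dagger V"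
  shows "U ** real_diag (f \<circ> d) ** dagger U = V ** real_diag (f \<circ> e) ** dagger V"
proof -
  define W where "W = dagger V ** U"
  have VV: "dagger V ** V = mat 1" "V ** dagger V = mat 1"
    and UU: "dagger U ** U = mat 1" "U ** dagger U = mat 1"
    using U V by (auto simp: unitary_def)
  have "W ** real_diag d = dagger V ** (U ** real_diag d ** dagger U) ** U"
    by (simp add: W_def matrix_mul_assoc[symmetric] UU)
  also have "\<dots> = (dagger V ** V) ** real_diag e ** W"
    unfolding eq by (simp add: W_def matrix_mul_assoc)
  finally have "W ** real_diag d = real_diag e ** W" by (simp add: VV)
  then have "W $ i $ j * of_real (d j) = of_real (e i) * W $ i $ j" for i j
    by (metis real_diag_mult_left real_diag_mult_right)
  then have "W $ i $ j = 0 \<or> d j = e i" for i j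
    by (metis mult.commute mult_left_cancel of_real_eq_iff)
  then have "W ** real_diag (f \<circ> d) = real_diag (f \<circ> e) ** W"
    unfolding vec_eq_iff real_diag_mult_left real_diag_mult_right
    by (metis comp_apply mult.commute mult_zero_left)
  then have "V ** (W ** real_diag (f \<circ> d)) ** dagger U = V ** (real_diag (f \<circ> e) ** W) ** dagger U"
    by simp
  moreover have "V ** (W ** real_diag (f \<circ> d)) ** dagger U
      = (V ** dagger V) ** U ** real_diag (f \<circ> d) ** dagger U"
    by (simp add: W_def matrix_mul_assoc)
  moreover have "V ** (real_diag (f \<circ> e) ** W) ** dagger U
      = V ** real_diag (f \<circ> e) ** dagger V ** (U ** dagger U)"
    by (simp add: W_def matrix_mul_assoc)
  ultimately show ?thesis by (simp add: VV UU)
qed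

lemma hermitian_fun_eq:
  assumes "unitary U" "A = U ** real_diag d ** dagger U"
  shows "hermitian_fun f A = U ** real_diag (f \<circ> d) ** dagger U"
  unfolding hermitian_fun_def
proof (rule the_equality)
  show "\<exists>V e. unitary V \<and> A = V ** real_diag e ** dagger V
      \<and> U ** real_diag (f \<circ> d) ** dagger U = V ** real_diag (f \<circ> e) ** dagger V"
    using assms by blast
next
  fix B
  assume "\<exists>V e. unitary V \<and> A = V ** real_diag e ** dagger V
      \<and> B = V ** real_diag (f \<circ> e) ** dagger V"
  then show "B = U ** real_diag (f \<circ> d) ** dagger U"
    using assms hermitian_fun_unique by metis
qed

end

(*
  Let P be a von Neumann measurement with outcome probabilities p_i in the state rho^B, whose
  eigenvalues are l_j. Since p = D l with D doubly stochastic, H(rho^B, P) >= S(rho^B). Any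
  two-dimensional subspace of C^2 (x) C^2 contains a product vector, because the determinant
  restricted to it is a binary quadratic form; in the span of two vectors of the basis of P such
  a vector has at most two possible outcomes, so the infimum over product states is at most 1.
  Hence M(rho^B) <= 1 - S(rho^B). Equality holds for the measurement in the given maximally
  entangled basis: there H(rho^B, P) = S(rho^B), and a product state overlaps a maximally
  entangled vector with probability at most 1/2, so its Klein entropy is at least 1.
*)

theory Submission
  imports Defs
begin

subsection \<open>Orthonormal families and rank-one projectors\<close>

definition outer :: "complex^'n \<Rightarrow> complex^'n^'n" where
  "outer x = (\<chi> i j. x $ i * cnj (x $ j))"

text \<open>Indexing by the coordinate type builds the cardinality into the type: the matrix with
  columns \<open>f j\<close> is square, so orthonormality alone makes \<open>f\<close> a
  basis.\<close>

definition onb :: "('n \<Rightarrow> complex^'n) \<Rightarrow> bool" where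
  "onb f \<longleftrightarrow> (\<forall>i j. cinner (f i) (f j) = (if i = j then 1 else 0))"

lemma cinner_add_left: "cinner (x + y) z = cinner x z + cinner y z"
  by (simp add: cinner_def algebra_simps sum.distrib)

lemma cinner_add_right: "cinner x (y + z) = cinner x y + cinner x z"
  by (simp add: cinner_def algebra_simps sum.distrib)

lemma cinner_diff_left: "cinner (x - y) z = cinner x z - cinner y z"
  by (simp add: cinner_def algebra_simps sum_subtractf)

lemma cinner_diff_right: "cinner x (y - z) = cinner x y - cinner x z"
  by (simp add: cinner_def algebra_simps sum_subtractf)

lemma cinner_scale_left: "cinner (c *s x) y = cnj c * cinner x y"
  by (simp add: cinner_def algebra_simps sum_distrib_left)

lemma cinner_scale_right: "cinner x (c *s y) = c * cinner x y"
  by (simp add: cinner_def algebra_simps sum_distrib_left)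

lemma cinner_zero_right [simp]: "cinner x 0 = 0"
  by (simp add: cinner_def)

lemma cnj_cinner: "cnj (cinner x y) = cinner y x"
  by (simp add: cinner_def mult.commute)

lemma cinner_sum_right: "cinner x (\<Sum>i\<in>I. y i) = (\<Sum>i\<in>I. cinner x (y i))"
  by (induction I rule: infinite_finite_induct) (simp_all add: cinner_add_right)

lemma cinner_self: "cinner x x = of_real (\<Sum>i\<in>UNIV. (cmod (x $ i))\<^sup>2)"
  by (simp add: cinner_def complex_norm_square mult.commute del: of_real_power)

lemma cinner_self_norm: "cinner x x = of_real ((norm x)\<^sup>2)"
  by (simp add: cinner_self norm_vec_def L2_set_def sum_nonneg)

lemma cinner_normalized:
  assumes "x \<noteq> 0"
  shows "cinner (of_real (1 / norm x) *s x) (of_real (1 / norm x) *s x) = 1"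
  unfolding cinner_scale_left cinner_scale_right unfolding cinner_self_norm
  using assms by (simp add: power2_eq_square)

lemma cinner_matrix_sum: "cinner x (A *v y) = (\<Sum>i\<in>UNIV. \<Sum>j\<in>UNIV. cnj (x $ i) * A $ i $ j * y $ j)"
  by (simp add: cinner_def matrix_vector_mult_def sum_distrib_left mult.assoc)

lemma cinner_dagger: "cinner x (A *v y) = cinner (dagger A *v x) y"
proof -
  have "cinner (dagger A *v x) y = (\<Sum>j\<in>UNIV. \<Sum>i\<in>UNIV. cnj (x $ i) * A $ i $ j * y $ j)"
    by (simp add: cinner_def dagger_def matrix_vector_mult_def sum_distrib_left sum_distrib_right mult_ac)
  also have "\<dots> = (\<Sum>i\<in>UNIV. \<Sum>j\<in>UNIV. cnj (x $ i) * A $ i $ j * y $ j)"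
    by (rule sum.swap)
  finally show ?thesis by (simp add: cinner_matrix_sum)
qed

lemma cnj_cinner_hermitian: "hermitian A \<Longrightarrow> cnj (cinner x (A *v y)) = cinner y (A *v x)"
  by (metis cinner_dagger cnj_cinner hermitian_def)

section \<open>Outer products and rank-one projectors\<close>

lemma outer_mult_vec: "outer x *v y = cinner x y *s x"
  by (simp add: outer_def cinner_def matrix_vector_mult_def vec_eq_iff sum_distrib_left sum_distrib_right mult_ac)

lemma trace_mult_outer: "trace (A ** outer x) = cinner x (A *v x)"
proof -
  have "trace (A ** outer x) = (\<Sum>i\<in>UNIV. \<Sum>j\<in>UNIV. cnj (x $ i) * A $ i $ j * x $ j)"
    by (simp add: trace_def outer_def matrix_matrix_mult_def mult_ac)
  then show ?thesis by (simp add: cinner_matrix_sum)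
qed

lemma trace_outer: "trace (outer x) = cinner x x"
  using trace_mult_outer[of "mat 1" x] by simp

lemma hermitian_outer: "hermitian (outer x)"
  by (simp add: hermitian_def dagger_def outer_def vec_eq_iff)

lemma outer_mult_outer: "outer x ** outer y = (\<chi> i j. cinner x y * x $ i * cnj (y $ j))"
  by (simp add: outer_def matrix_matrix_mult_def cinner_def vec_eq_iff sum_distrib_left sum_distrib_right mult_ac)

lemma cinner_outer: "cinner y (outer x *v y) = of_real ((cmod (cinner x y))\<^sup>2)"
  by (metis cinner_scale_right cnj_cinner complex_norm_square mult.commute outer_mult_vec)

lemma state_outer:
  assumes "cinner x x = 1"
  shows "state (outer x)"
  by (simp add: state_def hermitian_outer cinner_outer trace_outer assms)

text \<open>All rows of \<open>outer x\<close> are multiples of the conjugate of \<open>x\<close>,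
  and one of them is nonzero, so the row space is a line.\<close>

lemma rank_one_projector_outer:
  assumes "cinner x x = 1"
  shows "rank_one_projector (outer x)"
proof -
  let ?y = "\<chi> j. cnj (x $ j)"
  have x: "x \<noteq> 0" using assms by auto
  then obtain k where k: "x $ k \<noteq> 0" by (auto simp: vec_eq_iff)
  have rows: "row i (outer x) = x $ i *s ?y" for i
    by (simp add: row_def outer_def vec_eq_iff)
  have "vec.span (rows (outer x)) = vec.span {?y}"
  proof (rule vec.span_eq[THEN iffD2], intro conjI subsetI)
    fix z assume "z \<in> rows (outer x)"
    then show "z \<in> vec.span {?y}" by (auto simp: rows_def rows vec.span_singleton)
  next
    fix z assume "z \<in> {?y}"
    then have "z = inverse (x $ k) *s row k (outer x)"
      using k by (simp add: rows vec.scale_scale)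
    then show "z \<in> vec.span (rows (outer x))"
      by (metis (mono_tags, lifting) UNIV_I mem_Collect_eq rows_def vec.span_base vec.span_scale)
  qed
  moreover have "?y \<noteq> 0" using k by (auto simp: vec_eq_iff)
  ultimately have "rank (outer x) = 1"
    unfolding row_rank_def_gen by (metis One_nat_def card.empty card.insert empty_iff finite.emptyI
        vec.dim_span vec.dim_eq_card vec.dependent_single)
  moreover have "outer x ** outer x = outer x"
    by (simp add: outer_mult_outer assms) (simp add: outer_def)
  ultimately show ?thesis by (simp add: rank_one_projector_def hermitian_outer)
qed

text \<open>Rank one gives \<open>P $ i $ j = c i * w $ j\<close>. Hermiticity makes
  \<open>w\<close> a multiple \<open>t\<close> of the conjugate of \<open>c\<close>, idempotence
  fixes \<open>t\<close> as the inverse squared norm of \<open>c\<close>, and normalizing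
  \<open>c\<close> absorbs it.\<close>

lemma rank_one_projector_imp_outer:
  assumes "rank_one_projector P"
  obtains x where "cinner x x = 1" "P = outer x"
proof -
  have herm: "hermitian P" and idem: "P ** P = P" and rk: "vec.dim (rows P) = 1"
    using assms by (auto simp: rank_one_projector_def row_rank_def_gen)
  obtain B where B: "B \<subseteq> rows P" "vec.independent B" "rows P \<subseteq> vec.span B" "card B = 1"
    using vec.basis_exists[of "rows P"] rk by metis
  then obtain w where w: "B = {w}" by (meson card_1_singletonE)
  have "row i P \<in> vec.span {w}" for i using B(3) w by (auto simp: rows_def)
  then have "\<forall>i. \<exists>c. row i P = c *s w" by (force simp: vec.span_singleton)
  then obtain c where "row i P = c i *s w" for i by metis
  then have P: "P $ i $ j = c i * w $ j" for i j
    by (metis row_def vec_lambda_eta vector_smult_component)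
  have "w \<noteq> 0" using B(2) w by (simp add: vec.dependent_single)
  obtain i0 where "row i0 P = w" using B(1) w by (auto simp: rows_def)
  with \<open>w \<noteq> 0\<close> P have c0: "c i0 \<noteq> 0"
    by (metis (no_types, lifting) mult_eq_0_iff row_def vec_eq_iff vec_lambda_beta zero_index)
  have hP: "cnj (P $ j $ i) = P $ i $ j" for i j
    using herm by (simp add: hermitian_def dagger_def vec_eq_iff)
  \<comment> \<open>This ratio comes from comparing row \<open>i0\<close> of \<open>P\<close> with
    the conjugate of column \<open>i0\<close>.\<close>
  define t where "t = cnj (w $ i0) / c i0"
  have wt: "w $ j = t * cnj (c j)" for j
    using hP[of j i0] c0 by (simp add: P t_def field_simps)
  define x where "x = (\<chi> i. c i)"
  have P': "P = (\<chi> i j. t * (x $ i * cnj (x $ j)))"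
    by (simp add: P wt x_def vec_eq_iff)
  have t0: "t \<noteq> 0" using wt \<open>w \<noteq> 0\<close> by (auto simp: vec_eq_iff)
  have "x \<noteq> 0" using c0 by (auto simp: x_def vec_eq_iff)
  have "(P ** P) $ i0 $ i0 = (t * cinner x x) * P $ i0 $ i0"
    by (simp add: P' matrix_matrix_mult_def cinner_def sum_distrib_left sum_distrib_right mult_ac)
  moreover have "P $ i0 $ i0 \<noteq> 0" using t0 c0 by (simp add: P' x_def)
  ultimately have tx: "t * cinner x x = 1" using idem by simp
  define n where "n = norm x"
  have n: "n > 0" "cinner x x = of_real (n\<^sup>2)" using \<open>x \<noteq> 0\<close> by (simp_all add: n_def cinner_self_norm)
  have t: "t = of_real (1 / n\<^sup>2)" using tx n by (simp add: field_simps)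
  define y where "y = of_real (1 / n) *s x"
  have "cinner y y = 1"
    unfolding y_def n_def by (rule cinner_normalized[OF \<open>x \<noteq> 0\<close>])
  moreover have "P = outer y"
    by (simp add: P' y_def outer_def t vec_eq_iff power2_eq_square)
  ultimately show thesis by (rule that)
qed

section \<open>Indexed orthonormal bases: completeness, Parseval, trace\<close>

lemma onb_unitary:
  assumes "onb f"
  shows "unitary (\<chi> i j. f j $ i)"
proof -
  let ?U = "\<chi> i j. f j $ i"
  have "dagger ?U ** ?U = mat 1"
    using assms by (simp add: dagger_def matrix_matrix_mult_def mat_def vec_eq_iff onb_def cinner_def)
  \<comment> \<open>Orthonormality is one of the two identities; for a square matrix it implies the
    other, which is the completeness relation.\<close>
  then show ?thesis by (simp add: unitary_def matrix_left_right_inverse[of "dagger ?U"])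
qed

lemma onb_sum_outer:
  assumes "onb f"
  shows "(\<Sum>i\<in>UNIV. outer (f i)) = mat 1"
proof -
  let ?U = "\<chi> i j. f j $ i"
  have "?U ** dagger ?U = (\<Sum>i\<in>UNIV. outer (f i))"
    by (simp add: dagger_def matrix_matrix_mult_def vec_eq_iff outer_def)
  then show ?thesis using onb_unitary[OF assms] by (simp add: unitary_def)
qed

lemma onb_expand:
  assumes "onb f"
  shows "x = (\<Sum>i\<in>UNIV. cinner (f i) x *s f i)"
proof -
  have *: "(\<Sum>i\<in>I. outer (f i)) *v x = (\<Sum>i\<in>I. cinner (f i) x *s f i)" for I
    by (induction I rule: infinite_finite_induct)
       (simp_all add: matrix_vector_mult_add_rdistrib outer_mult_vec)
  show ?thesis using *[of UNIV] by (simp add: onb_sum_outer[OF assms])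
qed

lemma onb_parseval:
  assumes "onb f"
  shows "cinner x y = (\<Sum>i\<in>UNIV. cinner (f i) y * cinner x (f i))"
  by (subst onb_expand[OF assms, of y]) (simp add: cinner_sum_right cinner_scale_right)

lemma onb_sum_cmod:
  assumes "onb f"
  shows "(\<Sum>i\<in>UNIV. (cmod (cinner (f i) x))\<^sup>2) = Re (cinner x x)"
proof -
  have "cinner x x = of_real (\<Sum>i\<in>UNIV. (cmod (cinner (f i) x))\<^sup>2)"
    by (subst onb_parseval[OF assms, of x x], subst of_real_sum, rule sum.cong)
       (auto simp: complex_norm_square cnj_cinner simp del: of_real_power)
  then show ?thesis by simp
qed

lemma onb_trace:
  assumes "onb f"
  shows "trace A = (\<Sum>i\<in>UNIV. cinner (f i) (A *v f i))"
proof -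
  have *: "trace (A ** (\<Sum>i\<in>I. outer (f i))) = (\<Sum>i\<in>I. cinner (f i) (A *v f i))" for I
    by (induction I rule: infinite_finite_induct)
       (simp_all add: matrix_add_ldistrib trace_add trace_mult_outer, simp_all add: trace_def)
  show ?thesis using *[of UNIV] by (simp add: onb_sum_outer[OF assms])
qed

lemma onb_inj: "onb f \<Longrightarrow> inj f"
  by (auto simp: inj_def onb_def) (metis zero_neq_one)

text \<open>Measurements are sets, so injectivity is what turns sums over projectors into sums over
  indices.\<close>

lemma inj_outer_onb: assumes "onb f" shows "inj (\<lambda>i. outer (f i))"
proof (rule injI)
  fix i j assume "outer (f i) = outer (f j)"
  then have "cinner (f i) (outer (f i) *v f i) = cinner (f i) (outer (f j) *v f i)" by simp
  then show "i = j" using assms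
    by (auto simp: cinner_outer onb_def split: if_splits)
qed

section \<open>Measurements and bases as indexed orthonormal families\<close>

lemma von_neumann_measurement_onb:
  assumes "onb f"
  shows "von_neumann_measurement (range (\<lambda>i. outer (f i)))"
  unfolding von_neumann_measurement_def
proof (intro conjI ballI impI)
  fix P assume "P \<in> range (\<lambda>i. outer (f i))"
  then show "rank_one_projector P"
    using assms by (auto intro!: rank_one_projector_outer simp: onb_def)
next
  fix P Q assume "P \<in> range (\<lambda>i. outer (f i))" "Q \<in> range (\<lambda>i. outer (f i))" "P \<noteq> Q"
  then show "P ** Q = 0"
    using assms by (auto simp: outer_mult_outer onb_def vec_eq_iff)
next
  show "\<Sum> (range (\<lambda>i. outer (f i))) = mat 1"
    using onb_sum_outer[OF assms] by (simp add: sum.reindex inj_outer_onb[OF assms])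
qed simp

text \<open>Each projector has trace 1, so the trace of the resolution of the identity counts the
  members of \<open>M\<close>. Their number is the dimension, hence the coordinate type can index
  them.\<close>

lemma von_neumann_measurement_imp_onb:
  fixes M :: "(complex^'n^'n) set"
  assumes "von_neumann_measurement M"
  obtains f where "onb f" "M = range (\<lambda>i. outer (f i))"
proof -
  have fin: "finite M" and proj: "\<And>P. P \<in> M \<Longrightarrow> rank_one_projector P"
    and orth: "\<And>P Q. P \<in> M \<Longrightarrow> Q \<in> M \<Longrightarrow> P \<noteq> Q \<Longrightarrow> P ** Q = 0" and sum: "\<Sum>M = mat 1"
    using assms by (auto simp: von_neumann_measurement_def)
  have "\<forall>P\<in>M. \<exists>x. cinner x x = 1 \<and> P = outer x"
    using proj rank_one_projector_imp_outer by metis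
  then obtain v where v: "\<And>P. P \<in> M \<Longrightarrow> cinner (v P) (v P) = 1" "\<And>P. P \<in> M \<Longrightarrow> P = outer (v P)"
    by metis
  have "trace (\<Sum>N) = of_nat (card N)" if "N \<subseteq> M" for N
    using finite_subset[OF that fin] that
  proof (induction N rule: finite_induct)
    case empty
    then show ?case by (simp add: trace_def)
  next
    case (insert P N)
    have "trace P = 1" using v[of P] insert.prems by (metis insert_subset trace_outer)
    then show ?case using insert by (simp add: trace_add)
  qed
  then have "of_nat (card M) = (trace (mat 1 :: complex^'n^'n))" using sum by (metis order_refl)
  then have "card M = CARD('n)" by (simp add: trace_I)
  then obtain g :: "'n \<Rightarrow> _" where g: "bij_betw g UNIV M"
    using fin finite_same_card_bij[of "UNIV :: 'n set" M] by auto
  have gM: "g i \<in> M" for i using g by (auto simp: bij_betw_def)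
  have "onb (\<lambda>i. v (g i))"
    unfolding onb_def
  proof (intro allI)
    fix i j
    show "cinner (v (g i)) (v (g j)) = (if i = j then 1 else 0)"
    proof (cases "i = j")
      case False
      then have "g i \<noteq> g j" using g by (auto simp: bij_betw_def inj_def)
      \<comment> \<open>Applied to \<open>v (g j)\<close>, the product of the two projectors yields
        the inner product in question times the unit vector \<open>v (g i)\<close>.\<close>
      then have "outer (v (g i)) *v (outer (v (g j)) *v v (g j)) = 0"
        using orth[OF gM gM] v(2)[OF gM] by (metis matrix_vector_mul_assoc matrix_vector_mult_0)
      then have "cinner (v (g i)) (v (g j)) *s v (g i) = 0"
        by (simp add: outer_mult_vec v(1)[OF gM])
      then have "cinner (v (g i)) (cinner (v (g i)) (v (g j)) *s v (g i)) = 0"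
        by (simp only: cinner_zero_right)
      then show ?thesis using False by (simp add: cinner_scale_right v(1)[OF gM])
    qed (simp add: v(1)[OF gM])
  qed
  moreover have "M = range (\<lambda>i. outer (v (g i)))"
    using g v(2)[OF gM] by (auto simp: bij_betw_def)
  ultimately show thesis by (rule that)
qed

lemma klein_entropy_onb:
  assumes "onb f"
  shows "klein_entropy \<rho> (range (\<lambda>i. outer (f i))) =
    - (\<Sum>i\<in>UNIV. Re (cinner (f i) (\<rho> *v f i)) * log 2 (Re (cinner (f i) (\<rho> *v f i))))"
  by (simp add: klein_entropy_def sum.reindex inj_outer_onb[OF assms] trace_mult_outer)

text \<open>Pairing a vanishing combination with a member of \<open>S\<close> isolates its
  coefficient, so \<open>S\<close> is independent; as it also spans, it has as many elements as
  there are coordinates.\<close>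

lemma orthonormal_basis_imp_onb:
  fixes S :: "(complex^'n) set"
  assumes "orthonormal_basis S"
  obtains f where "onb f" "S = range f"
proof -
  have on: "\<And>x y. x \<in> S \<Longrightarrow> y \<in> S \<Longrightarrow> cinner x y = (if x = y then 1 else 0)"
    and span: "vec.span S = UNIV"
    using assms by (auto simp: orthonormal_basis_def orthonormal_def)
  have ind: "vec.independent S"
    unfolding vec.dependent_explicit
  proof clarify
    fix T u x assume T: "finite T" "T \<subseteq> S" "(\<Sum>v\<in>T. u v *s v) = 0" "x \<in> T" "u x \<noteq> 0"
    have "0 = (\<Sum>v\<in>T. u v * cinner x v)"
      using arg_cong[OF T(3), of "cinner x"] by (simp add: cinner_sum_right cinner_scale_right)
    also have "\<dots> = (\<Sum>v\<in>T. if v = x then u v else 0)"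
      using T on by (intro sum.cong) (auto simp: subset_iff)
    also have "\<dots> = u x" using T by simp
    finally show False using T by simp
  qed
  have "card S = CARD('n)"
    using vec.basis_card_eq_dim[of S UNIV] ind span vec_dim_card[where 'a=complex and 'n='n] by auto
  moreover have "finite S" using ind vec.finiteI_independent by blast
  ultimately obtain g :: "'n \<Rightarrow> _" where g: "bij_betw g UNIV S"
    using finite_same_card_bij[of "UNIV :: 'n set" S] by auto
  have "onb g"
    using g on by (auto simp: onb_def bij_betw_def inj_def)
  then show thesis using g that by (auto simp: bij_betw_def)
qed

subsection \<open>Entropy comparison\<close>

lemma state_quadratic_nonneg: "state \<rho> \<Longrightarrow> 0 \<le> Re (cinner v (\<rho> *v v))"
  by (simp add: state_def)

lemma state_quadratic_real:
  assumes "state \<rho>"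
  shows "cinner v (\<rho> *v v) = of_real (Re (cinner v (\<rho> *v v)))"
  using assms cnj_cinner_hermitian[of \<rho> v v]
  by (simp add: state_def complex_eq_iff)

lemma state_sum_onb:
  assumes "state \<rho>" "onb f"
  shows "(\<Sum>i\<in>UNIV. Re (cinner (f i) (\<rho> *v f i))) = 1"
proof -
  have "(\<Sum>i\<in>UNIV. cinner (f i) (\<rho> *v f i)) = 1"
    using assms onb_trace[of f \<rho>] by (simp add: state_def)
  from arg_cong[OF this, of Re] show ?thesis by simp
qed

text \<open>The unitary with columns \<open>f j\<close> diagonalises \<rho>, so
  \<open>hermitian_fun_eq\<close> evaluates the logarithm, and cyclicity of the trace removes the
  unitary.\<close>

lemma von_neumann_entropy_onb:
  fixes f :: "'n \<Rightarrow> complex^'n"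
  assumes \<rho>: "state \<rho>" and f: "onb f" and diag: "diagonal_in (range f) \<rho>"
  shows "von_neumann_entropy \<rho> =
    - (\<Sum>i\<in>UNIV. Re (cinner (f i) (\<rho> *v f i)) * log 2 (Re (cinner (f i) (\<rho> *v f i))))"
proof -
  define d where "d i = Re (cinner (f i) (\<rho> *v f i))" for i
  define U where "U = (\<chi> i j. f j $ i)"
  have U: "unitary U" unfolding U_def by (rule onb_unitary[OF f])
  then have UU: "dagger U ** U = mat 1" "U ** dagger U = mat 1" by (auto simp: unitary_def)
  have "dagger U ** (\<rho> ** U) = real_diag d"
  proof -
    have "(dagger U ** (\<rho> ** U)) $ i $ j = cinner (f i) (\<rho> *v f j)" for i j
      by (simp add: U_def dagger_def matrix_matrix_mult_def cinner_def matrix_vector_mult_def)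
    moreover have "cinner (f i) (\<rho> *v f j) = (if i = j then of_real (d i) else 0)" for i j
      unfolding d_def using diag state_quadratic_real[OF \<rho>, of "f i"] onb_inj[OF f]
      by (auto simp: diagonal_in_def inj_eq)
    ultimately show ?thesis by (simp add: vec_eq_iff real_diag_def)
  qed
  then have "U ** real_diag d ** dagger U = (U ** dagger U) ** \<rho> ** (U ** dagger U)"
    by (metis matrix_mul_assoc)
  then have \<rho>_eq: "\<rho> = U ** real_diag d ** dagger U" by (simp add: UU)
  have "\<rho> ** hermitian_fun (log 2) \<rho>
      = U ** (real_diag d ** (dagger U ** U) ** real_diag (log 2 \<circ> d)) ** dagger U"
    by (subst \<rho>_eq, subst hermitian_fun_eq[OF U \<rho>_eq]) (simp add: matrix_mul_assoc)
  also have "trace \<dots> = trace (dagger U ** (U ** (real_diag d ** real_diag (log 2 \<circ> d))))"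
    by (subst trace_mul_sym) (simp add: UU)
  also have "\<dots> = trace (real_diag d ** real_diag (log 2 \<circ> d))"
    by (simp add: matrix_mul_assoc UU)
  also have "\<dots> = (\<Sum>i\<in>UNIV. of_real (d i * log 2 (d i)))"
    unfolding trace_def real_diag_mult_left by (simp add: real_diag_def)
  finally show ?thesis by (simp add: von_neumann_entropy_def d_def)
qed

text \<open>This is ln t \<le> t - 1 at t = y / x, multiplied by x: the termwise form of the
  nonnegativity of relative entropy.\<close>

lemma diff_le_mult_ln_diff:
  fixes x y :: real
  assumes "0 < x" "0 < y"
  shows "x - y \<le> x * (ln x - ln y)"
proof -
  have "ln (y / x) \<le> y / x - 1" using assms by (intro ln_le_minus_one) simp
  then have "x * (ln y - ln x) \<le> x * (y / x - 1)"
    using assms by (intro mult_left_mono) (simp_all add: ln_div)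
  then show ?thesis using assms by (simp add: algebra_simps)
qed

text \<open>Weight \<open>diff_le_mult_ln_diff\<close> for \<open>l j\<close> and \<open>p i\<close>
  by \<open>D i j\<close> and sum. The left side vanishes because \<open>p\<close> and
  \<open>l\<close> have equal totals; the right side collapses to the difference of the two entropy
  sums by the column sums and the definition of \<open>p\<close>.\<close>

lemma doubly_stochastic_entropy_le:
  fixes l :: "'a::finite \<Rightarrow> real" and D :: "'b::finite \<Rightarrow> 'a \<Rightarrow> real"
  assumes l: "\<And>j. 0 \<le> l j" and D: "\<And>i j. 0 \<le> D i j"
    and row: "\<And>i. (\<Sum>j\<in>UNIV. D i j) = 1" and col: "\<And>j. (\<Sum>i\<in>UNIV. D i j) = 1"
    and p: "\<And>i. p i = (\<Sum>j\<in>UNIV. D i j * l j)"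
  shows "(\<Sum>i\<in>UNIV. p i * log 2 (p i)) \<le> (\<Sum>j\<in>UNIV. l j * log 2 (l j))"
proof -
  have p0: "0 \<le> p i" for i by (simp add: p l D sum_nonneg)
  have key: "D i j * (l j - p i) \<le> D i j * l j * (ln (l j) - ln (p i))" for i j
  \<comment> \<open>With weight zero the right side is 0 and the left side is at most 0, whatever
    the logarithms are. Otherwise \<open>p i\<close> is at least the positive weight, so both
    logarithms have positive arguments.\<close>
  proof (cases "D i j * l j = 0")
    case True
    then show ?thesis using D[of i j] p0[of i] by (auto simp: mult_le_0_iff)
  next
    case False
    then have pos: "0 < D i j" "0 < l j" using D l by (auto simp: less_le)
    have "D i j * l j \<le> p i" unfolding p
      by (rule member_le_sum) (auto simp: D l)
    with pos have "0 < p i" by (metis less_le_trans mult_pos_pos)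
    then have "D i j * (l j - p i) \<le> D i j * (l j * (ln (l j) - ln (p i)))"
      using pos by (intro mult_left_mono diff_le_mult_ln_diff) auto
    then show ?thesis by (simp add: mult.assoc)
  qed
  have A: "(\<Sum>i\<in>UNIV. \<Sum>j\<in>UNIV. D i j * (c j * 1)) = (\<Sum>j\<in>UNIV. c j)" for c
    by (subst sum.swap) (simp add: col flip: sum_distrib_right)
  have B: "(\<Sum>i\<in>UNIV. \<Sum>j\<in>UNIV. D i j * c i) = (\<Sum>i\<in>UNIV. c i)" for c
    by (simp add: row flip: sum_distrib_right)
  have "(\<Sum>i\<in>UNIV. p i) = (\<Sum>j\<in>UNIV. l j)" using A[of l] by (simp add: p)
  then have "0 = (\<Sum>i\<in>UNIV. \<Sum>j\<in>UNIV. D i j * (l j - p i))"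
    using A[of l] B[of p] by (simp add: right_diff_distrib sum_subtractf)
  also have "\<dots> \<le> (\<Sum>i\<in>UNIV. \<Sum>j\<in>UNIV. D i j * l j * (ln (l j) - ln (p i)))"
    by (intro sum_mono key)
  also have "\<dots> = (\<Sum>j\<in>UNIV. l j * ln (l j)) - (\<Sum>i\<in>UNIV. p i * ln (p i))"
    using A[of "\<lambda>j. l j * ln (l j)"]
    by (simp add: right_diff_distrib sum_subtractf mult.assoc)
       (simp add: p sum_distrib_right mult.assoc)
  finally show ?thesis
    by (simp add: log_def divide_right_mono flip: sum_divide_distrib)
qed

text \<open>The squared overlaps between the measurement basis \<open>f\<close> and the eigenbasis
  \<open>g\<close> form a doubly stochastic matrix, by Parseval in each basis, and it maps the
  eigenvalues to the outcome probabilities.\<close>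

lemma von_neumann_entropy_le_klein_entropy:
  fixes M :: "(complex^'n^'n) set"
  assumes \<rho>: "state \<rho>" and g: "onb g" and diag: "diagonal_in (range g) \<rho>"
    and M: "von_neumann_measurement M"
  shows "von_neumann_entropy \<rho> \<le> klein_entropy \<rho> M"
proof -
  obtain f where f: "onb f" "M = range (\<lambda>i. outer (f i))"
    using von_neumann_measurement_imp_onb[OF M] by metis
  define l where "l j = Re (cinner (g j) (\<rho> *v g j))" for j
  have ql: "\<rho> *v g j = of_real (l j) *s g j" for j
  proof -
    have "\<rho> *v g j = (\<Sum>i\<in>UNIV. cinner (g i) (\<rho> *v g j) *s g i)"
      by (rule onb_expand[OF g])
    also have "\<dots> = (\<Sum>i\<in>UNIV. if i = j then of_real (l j) *s g j else 0)"
      unfolding l_def using diag onb_inj[OF g] state_quadratic_real[OF \<rho>, of "g j"]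
      by (intro sum.cong) (auto simp: diagonal_in_def inj_eq)
    finally show ?thesis by simp
  qed
  have p: "Re (cinner x (\<rho> *v x)) = (\<Sum>j\<in>UNIV. (cmod (cinner x (g j)))\<^sup>2 * l j)" for x
  proof -
    have "cinner (g j) (\<rho> *v x) = of_real (l j) * cinner (g j) x" for j
      using \<rho> cinner_dagger[of "g j" \<rho> x]
      by (simp add: state_def hermitian_def ql cinner_scale_left)
    then have "cinner x (\<rho> *v x) = (\<Sum>j\<in>UNIV. of_real ((cmod (cinner x (g j)))\<^sup>2 * l j))"
      by (subst onb_parseval[OF g], intro sum.cong)
         (auto simp: complex_norm_square cnj_cinner simp del: of_real_power)
    then show ?thesis by simp
  qed
  have "(\<Sum>i\<in>UNIV. Re (cinner (f i) (\<rho> *v f i)) * log 2 (Re (cinner (f i) (\<rho> *v f i))))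
      \<le> (\<Sum>j\<in>UNIV. l j * log 2 (l j))"
  proof (rule doubly_stochastic_entropy_le[where D = "\<lambda>i j. (cmod (cinner (f i) (g j)))\<^sup>2"])
    show "(\<Sum>i\<in>UNIV. (cmod (cinner (f i) (g j)))\<^sup>2) = 1" for j
      using onb_sum_cmod[OF f(1), of "g j"] g by (simp add: onb_def)
    have "cmod (cinner (f i) (g j)) = cmod (cinner (g j) (f i))" for i j
      by (metis cnj_cinner complex_mod_cnj)
    then show "(\<Sum>j\<in>UNIV. (cmod (cinner (f i) (g j)))\<^sup>2) = 1" for i
      using onb_sum_cmod[OF g, of "f i"] f(1) by (simp add: onb_def)
    show "0 \<le> l j" for j
      using \<rho> by (simp add: l_def state_quadratic_nonneg)
  qed (simp_all add: p)
  then show ?thesis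
    by (simp add: von_neumann_entropy_onb[OF \<rho> g diag] klein_entropy_onb[OF f(1)] f(2) l_def)
qed


subsection \<open>Product states\<close>

lemma sum_UNIV_prod: "(\<Sum>p\<in>UNIV. f p) = (\<Sum>i\<in>UNIV. \<Sum>j\<in>UNIV. f (i, j))"
  by (simp add: sum.cartesian_product)

lemma cinner_tensor: "cinner (tensor_vec a b) (tensor_vec c d) = cinner a c * cinner b d"
  by (simp add: cinner_def tensor_vec_def sum_UNIV_prod sum_product mult_ac)

lemma tensor_op_mult_vec: "tensor_op A B *v tensor_vec x y = tensor_vec (A *v x) (B *v y)"
  by (simp add: matrix_vector_mult_def tensor_vec_def tensor_op_def sum_UNIV_prod sum_product
      mult_ac vec_eq_iff)

lemma tensor_op_outer: "tensor_op (outer x) (outer y) = outer (tensor_vec x y)"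
  by (simp add: tensor_op_def outer_def tensor_vec_def vec_eq_iff mult_ac)

text \<open>A Cholesky factorisation: for a > 0 the first column divided by sqrt a leaves only the
  Schur complement \<open>s\<close>; for a = 0 positivity forces the off-diagonal entry to vanish.
  It serves to prove positivity of tensor products.\<close>

lemma positive_2_decomposition:
  fixes A :: "complex^2^2"
  assumes "hermitian A" and pos: "\<And>v. 0 \<le> Re (cinner v (A *v v))"
  obtains x y where "A = outer x + outer y"
proof -
  have h: "A $ i $ j = cnj (A $ j $ i)" for i j
    using assms(1) by (simp add: hermitian_def dagger_def vec_eq_iff)
  have q: "cinner v (A *v v) = cnj (v$1) * A$1$1 * v$1 + cnj (v$1) * A$1$2 * v$2
      + (cnj (v$2) * A$2$1 * v$1 + cnj (v$2) * A$2$2 * v$2)" for v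
    by (simp add: cinner_matrix_sum sum_2)
  define a b d where "a = Re (A $ 1 $ 1)" and "b = A $ 2 $ 1" and "d = Re (A $ 2 $ 2)"
  have A: "A $ 1 $ 1 = of_real a" "A $ 2 $ 1 = b" "A $ 1 $ 2 = cnj b" "A $ 2 $ 2 = of_real d"
    using h[of 1 1] h[of 1 2] h[of 2 2] by (auto simp: a_def b_def d_def complex_eq_iff)
  have a0: "0 \<le> a" using pos[of "vector [1, 0]"] by (simp add: q A)
  have d0: "0 \<le> d" using pos[of "vector [0, 1]"] by (simp add: q A)
  have form: "0 \<le> a * (cmod u)\<^sup>2 + d * (cmod v)\<^sup>2 + 2 * Re (cnj v * b * u)" for u v
  proof -
    have "cinner (vector [u, v]) (A *v vector [u, v])
        = of_real a * (u * cnj u) + of_real d * (v * cnj v) + (cnj v * b * u + cnj (cnj v * b * u))"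
      by (simp add: q A algebra_simps)
    also have "\<dots> = of_real (a * (cmod u)\<^sup>2 + d * (cmod v)\<^sup>2 + 2 * Re (cnj v * b * u))"
      by (simp only: complex_norm_square[symmetric] complex_add_cnj of_real_add of_real_mult)
    finally show ?thesis using pos[of "vector [u, v]"] by (metis Re_complex_of_real)
  qed
  show thesis
  proof (cases "a = 0")
    case True
    have "b = 0"
    proof (rule ccontr)
      assume b: "b \<noteq> 0"
      \<comment> \<open>With a = 0 the form at (-t, b) is affine in t with negative slope, and t = d
        + 1 makes it negative.\<close>
      have "0 \<le> d * (cmod b)\<^sup>2 - 2 * (t * (cmod b)\<^sup>2)" for t
        using form[of "- of_real t" b] True
        by (simp add: mult.commute[of _ b] complex_norm_square[symmetric] mult_ac flip: of_real_power)
      from this[of "d + 1"] have "0 \<le> (- d - 2) * (cmod b)\<^sup>2" by (simp add: algebra_simps)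
      then show False using b d0 by (simp add: zero_le_mult_iff)
    qed
    then have "A = outer (vector [0, of_real (sqrt d)]) + outer (vector [0, 0])"
      using True d0 by (simp add: vec_eq_iff forall_2 outer_def A flip: of_real_mult)
    then show ?thesis by (rule that)
  next
    case False
    with a0 have a: "a > 0" by simp
    define s where "s = d - (cmod b)\<^sup>2 / a"
    have s: "0 \<le> s"
    proof -
      \<comment> \<open>For second coordinate a, the first coordinate \<open>- cnj b\<close>
        minimises the form; its value there is a times the determinant.\<close>
      have "0 \<le> a * (cmod b)\<^sup>2 + d * a\<^sup>2 - 2 * a * (cmod b)\<^sup>2"
        using form[of "- cnj b" "of_real a"]
        by (simp add: mult.assoc complex_norm_square[symmetric] flip: of_real_power)
      then have "0 \<le> a * (d * a - (cmod b)\<^sup>2)" by (simp add: algebra_simps power2_eq_square)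
      then have "0 \<le> d * a - (cmod b)\<^sup>2" using a by (simp add: zero_le_mult_iff)
      then show ?thesis using a by (simp add: s_def field_simps)
    qed
    have bb: "b * cnj b = of_real ((cmod b)\<^sup>2)" by (simp add: complex_norm_square del: of_real_power)
    have sa: "sqrt a * sqrt a = a" "sqrt s * sqrt s = s" using a s by auto
    have "A = outer (vector [of_real (sqrt a), b / of_real (sqrt a)]) + outer (vector [0, of_real (sqrt s)])"
      using a s bb
      by (simp add: vec_eq_iff forall_2 outer_def A sa flip: of_real_mult)
         (simp add: s_def field_simps)
    then show ?thesis by (rule that)
  qed
qed

text \<open>Splitting \<open>A\<close> into outer products suffices for positivity: the expectation
  of \<open>tensor_op (outer z) B\<close> in \<open>v\<close> is that of \<open>B\<close> in the
  vector got by contracting the first factor of \<open>v\<close> with \<open>z\<close>.\<close>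

lemma state_tensor_op:
  fixes A B :: "complex^2^2"
  assumes A: "state A" and B: "state B"
  shows "state (tensor_op A B)"
proof -
  obtain x y where xy: "A = outer x + outer y"
    using positive_2_decomposition[of A] A by (auto simp: state_def)
  have out: "cinner v (tensor_op (outer z) B *v v) = cinner w (B *v w)"
    if w: "w = (\<chi> j. \<Sum>i\<in>UNIV. cnj (z $ i) * v $ (i, j))" for v w and z :: "complex^2"
    unfolding w by (simp add: cinner_matrix_sum tensor_op_def outer_def sum_UNIV_prod sum_2 algebra_simps)
  have "tensor_op A B = tensor_op (outer x) B + tensor_op (outer y) B"
    by (simp add: xy tensor_op_def vec_eq_iff algebra_simps)
  then have "0 \<le> Re (cinner v (tensor_op A B *v v))" for v
    using B by (simp add: matrix_vector_mult_add_rdistrib cinner_add_right out[OF refl] state_def)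
  moreover have "hermitian (tensor_op A B)"
    using A B by (simp add: state_def hermitian_def dagger_def tensor_op_def vec_eq_iff)
  moreover have "trace (tensor_op A B) = trace A * trace B"
    by (simp add: trace_def tensor_op_def sum_UNIV_prod sum_product)
  ultimately show ?thesis using A B by (simp add: state_def)
qed

text \<open>Transposing amounts to conjugating both vectors and exchanging them. This gives
  positivity of the transpose and the matrix entries of \<open>transpose B\<close> between
  conjugated vectors.\<close>

lemma cinner_transpose:
  "cinner (\<chi> i. cnj (x $ i)) (transpose B *v (\<chi> i. cnj (y $ i))) = cinner y (B *v x)"
proof -
  have "cinner y (B *v x) = (\<Sum>j\<in>UNIV. \<Sum>i\<in>UNIV. cnj (y $ i) * B $ i $ j * x $ j)"
    unfolding cinner_matrix_sum by (rule sum.swap)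
  then show ?thesis by (simp add: cinner_matrix_sum transpose_def mult_ac)
qed

lemma state_transpose:
  assumes "state B"
  shows "state (transpose B)"
proof -
  have "0 \<le> Re (cinner v (transpose B *v v))" for v
    using assms cinner_transpose[of "\<chi> i. cnj (v $ i)" B "\<chi> i. cnj (v $ i)"] by (simp add: state_def)
  moreover have "hermitian (transpose B)" "trace (transpose B) = 1"
    using assms by (auto simp: state_def hermitian_def dagger_def transpose_def vec_eq_iff trace_def)
  ultimately show ?thesis by (simp add: state_def)
qed

text \<open>
  With \<open>A\<^sub>i\<^sub>j = \<langle>a\<^sub>i, A a\<^sub>j\<rangle>\<close> and \<open>B\<^sub>i\<^sub>j = \<langle>b\<^sub>i, B b\<^sub>j\<rangle>\<close>, twice the expectation of
  \<open>A \<otimes> B\<close> in \<open>\<psi>\<close> is \<open>\<Sum>\<^sub>i\<^sub>j A\<^sub>i\<^sub>j B\<^sub>i\<^sub>j\<close>. It differs from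
  \<open>(A\<^sub>1\<^sub>1 + A\<^sub>2\<^sub>2) (B\<^sub>1\<^sub>1 + B\<^sub>2\<^sub>2) = 1\<close> by the expectation of the state \<open>A \<otimes> B\<^sup>T\<close> in the
  vector \<open>\<phi>\<close> below.
\<close>

lemma maximally_entangled_product_le_half:
  assumes A: "state A" and B: "state B" and "maximally_entangled \<psi>"
  shows "Re (cinner \<psi> (tensor_op A B *v \<psi>)) \<le> 1 / 2"
proof -
  obtain a b :: "2 \<Rightarrow> complex^2" where a: "onb a" and b: "onb b"
    and \<psi>: "\<psi> = (\<Sum>i\<in>UNIV. complex_of_real (1 / sqrt 2) *s tensor_vec (a i) (b i))"
    using assms(3) by (auto simp: maximally_entangled_def onb_def)
  define r where "r i j = cinner (a i) (A *v a j)" for i j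
  define s where "s i j = cinner (b i) (B *v b j)" for i j
  define \<phi> where "\<phi> = tensor_vec (a 1) (\<chi> i. cnj (b 2 $ i)) - tensor_vec (a 2) (\<chi> i. cnj (b 1 $ i))"
  define c where "c = complex_of_real (1 / sqrt 2)"
  have c: "c * c = 1 / 2" "cnj c = c"
    by (simp_all add: c_def flip: of_real_mult)
  have "cinner \<psi> (tensor_op A B *v \<psi>) =
      (c * c) *
        (r 1 1 * s 1 1 + r 1 2 * s 1 2 + r 2 1 * s 2 1 + r 2 2 * s 2 2)"
    unfolding \<psi> sum_2 c_def[symmetric]
    by (simp add: c(2) matrix_vector_right_distrib vector_scalar_commute tensor_op_mult_vec
        cinner_add_left cinner_add_right cinner_scale_left cinner_scale_right cinner_tensor
        r_def s_def algebra_simps)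
  then have p: "2 * cinner \<psi> (tensor_op A B *v \<psi>) =
      r 1 1 * s 1 1 + r 1 2 * s 1 2 + r 2 1 * s 2 1 + r 2 2 * s 2 2"
    by (simp only: c(1)) simp
  \<comment> \<open>The exchange in \<open>cinner_transpose\<close> produces \<open>s 1 2\<close>
    and \<open>s 2 1\<close> again, now with the minus sign of \<phi>, so these terms cancel against
    those of \<open>p\<close>.\<close>
  have q: "cinner \<phi> (tensor_op A (transpose B) *v \<phi>) =
      r 1 1 * s 2 2 - r 1 2 * s 1 2 - r 2 1 * s 2 1 + r 2 2 * s 1 1"
    unfolding \<phi>_def
    by (simp add: matrix_vector_mult_diff_distrib tensor_op_mult_vec cinner_diff_left
        cinner_diff_right cinner_tensor cinner_transpose r_def s_def algebra_simps
        del: transpose_matrix_vector)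
  have "r 1 1 + r 2 2 = 1" "s 1 1 + s 2 2 = 1"
    using onb_trace[OF a, of A] onb_trace[OF b, of B] A B by (simp_all add: r_def s_def state_def sum_2)
  then have "(r 1 1 + r 2 2) * (s 1 1 + s 2 2) = 1" by simp
  then have "2 * cinner \<psi> (tensor_op A B *v \<psi>) + cinner \<phi> (tensor_op A (transpose B) *v \<phi>) = 1"
    unfolding p q by (simp add: algebra_simps)
  from arg_cong[OF this, of Re]
  have "2 * Re (cinner \<psi> (tensor_op A B *v \<psi>)) + Re (cinner \<phi> (tensor_op A (transpose B) *v \<phi>)) = 1"
    by simp
  then show ?thesis
    using state_quadratic_nonneg[OF state_tensor_op[OF A state_transpose[OF B]], of \<phi>] by linarith
qed

text \<open>Every probability p is at most 1/2, so -log p \<ge> 1 whenever p > 0 and each term of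
  the entropy is at least p; the probabilities sum to 1.\<close>

lemma klein_entropy_product_ge_1:
  assumes f: "onb f" and me: "\<And>i. maximally_entangled (f i)" and \<delta>: "\<delta> \<in> product_states"
  shows "1 \<le> klein_entropy \<delta> (range (\<lambda>i. outer (f i)))"
proof -
  obtain A B where AB: "state A" "state B" "\<delta> = tensor_op A B"
    using \<delta> by (auto simp: product_states_def)
  have st: "state \<delta>" using AB state_tensor_op by simp
  let ?p = "\<lambda>i. Re (cinner (f i) (\<delta> *v f i))"
  have "?p i \<le> - (?p i * log 2 (?p i))" for i
  proof (cases "?p i = 0")
    case False
    then have pos: "?p i > 0" using state_quadratic_nonneg[OF st, of "f i"] by simp
    have "?p i \<le> 1 / 2" using maximally_entangled_product_le_half AB me by simp
    then have "log 2 (?p i) \<le> log 2 (1 / 2)" using pos by simp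
    then have "log 2 (?p i) \<le> -1" by (simp add: log_divide)
    then have "?p i * log 2 (?p i) \<le> ?p i * (-1)" using pos by (intro mult_left_mono) auto
    then show ?thesis by simp
  qed simp
  then have "(\<Sum>i\<in>UNIV. ?p i) \<le> (\<Sum>i\<in>UNIV. - (?p i * log 2 (?p i)))" by (intro sum_mono)
  then show ?thesis
    by (simp add: state_sum_onb[OF st f] klein_entropy_onb[OF f] sum_negf)
qed

text \<open>Supplies the lower bound without which a real-valued \<open>INF\<close> need not lie
  below its members.\<close>

lemma klein_entropy_nonneg:
  fixes \<rho> :: "complex^'n^'n"
  assumes \<rho>: "state \<rho>" and M: "von_neumann_measurement M"
  shows "0 \<le> klein_entropy \<rho> M"
proof -
  obtain f where f: "onb f" "M = range (\<lambda>i. outer (f i))"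
    using von_neumann_measurement_imp_onb[OF M] by metis
  let ?p = "\<lambda>i. Re (cinner (f i) (\<rho> *v f i))"
  have p0: "0 \<le> ?p i" for i by (rule state_quadratic_nonneg[OF \<rho>])
  have "?p i \<le> (\<Sum>i\<in>UNIV. ?p i)" for i by (rule member_le_sum) (auto simp: p0)
  then have "?p i \<le> 1" for i using state_sum_onb[OF \<rho> f(1)] by simp
  then have "?p i * log 2 (?p i) \<le> 0" for i
    using p0[of i] by (cases "?p i = 0") (auto simp: mult_le_0_iff less_le)
  then show ?thesis by (simp add: f(2) klein_entropy_onb[OF f(1)] sum_nonpos)
qed

section \<open>A product state with Klein entropy at most 1\<close>

lemma binary_entropy_le_1:
  fixes p q :: real
  assumes "0 \<le> p" "0 \<le> q" "p + q = 1"
  shows "- (p * log 2 p) - q * log 2 q \<le> 1"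
proof -
  \<comment> \<open>Comparison with the uniform distribution on two points: the left sides for p and
    q add up to 0.\<close>
  have *: "x - 1 / 2 \<le> x * ln x + x * ln 2" if "0 \<le> x" for x :: real
    using diff_le_mult_ln_diff[of x "1 / 2"] that
    by (cases "x = 0") (auto simp: ln_div algebra_simps)
  have "0 \<le> p * ln p + q * ln q + (p * ln 2 + q * ln 2)"
    using *[OF assms(1)] *[OF assms(2)] assms(3) by linarith
  also have "p * ln 2 + q * ln 2 = ln 2"
    using assms(3) by (simp flip: distrib_right)
  finally show ?thesis by (simp add: log_def field_simps)
qed

text \<open>If \<open>a\<close> vanishes, (1, 0) is a zero; otherwise \<beta> = 1 leaves a quadratic
  equation, solved with a complex root of the discriminant.\<close>

lemma complex_quadratic_form_zero:
  obtains \<alpha> \<beta> :: complex where "(\<alpha>, \<beta>) \<noteq> (0, 0)" "a * \<alpha>\<^sup>2 + b * \<alpha> * \<beta> + c * \<beta>\<^sup>2 = 0"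
proof (cases "a = 0")
  case True
  then show ?thesis by (intro that[of 1 0]) auto
next
  case False
  let ?r = "csqrt (b\<^sup>2 - 4 * a * c)"
  have "?r\<^sup>2 = b\<^sup>2 - 4 * a * c" by simp
  moreover have "a * ((- b + ?r) / (2 * a))\<^sup>2 + b * ((- b + ?r) / (2 * a)) + c
      = (?r\<^sup>2 - (b\<^sup>2 - 4 * a * c)) / (4 * a)"
    using False by (simp add: field_simps power2_eq_square del: power2_csqrt)
  ultimately show ?thesis using that[of "(- b + ?r) / (2 * a)" 1] by simp
qed

text \<open>Read as a 2 by 2 matrix, \<open>w\<close> is singular, so a nonzero first row spans its
  rows. The cases locate a pivot in that row; if it is zero, the second row alone remains.\<close>

lemma tensor_vec_of_det_zero:
  fixes w :: two_qubit_vec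
  assumes "w $ (1, 1) * w $ (2, 2) = w $ (1, 2) * w $ (2, 1)"
  obtains x y where "w = tensor_vec x y"
proof -
  have eq: "w = tensor_vec x y \<longleftrightarrow> (\<forall>i j. w $ (i, j) = x $ i * y $ j)" for x y
    by (simp add: tensor_vec_def vec_eq_iff)
  consider "w $ (1, 1) \<noteq> 0" | "w $ (1, 1) = 0" "w $ (1, 2) \<noteq> 0" | "w $ (1, 1) = 0" "w $ (1, 2) = 0"
    by blast
  then show thesis
  proof cases
    case 1
    then show ?thesis
      using assms
      by (intro that[of "vector [1, w $ (2, 1) / w $ (1, 1)]" "vector [w $ (1, 1), w $ (1, 2)]"])
        (simp add: eq forall_2 field_simps)
  next
    case 2
    then show ?thesis
      using assms
      by (intro that[of "vector [1, w $ (2, 2) / w $ (1, 2)]" "vector [w $ (1, 1), w $ (1, 2)]"])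
        (simp add: eq forall_2)
  next
    case 3
    then show ?thesis
      by (intro that[of "vector [0, 1]" "vector [w $ (2, 1), w $ (2, 2)]"]) (simp add: eq forall_2)
  qed
qed

text \<open>The three coefficients are those of the determinant of \<alpha> u + \<beta> v as a form
  in \<alpha> and \<beta>.\<close>

lemma product_vector_in_plane:
  fixes u v :: two_qubit_vec
  obtains \<alpha> \<beta> x y where "(\<alpha>, \<beta>) \<noteq> (0, 0)" "\<alpha> *s u + \<beta> *s v = tensor_vec x y"
proof -
  obtain \<alpha> \<beta> where ab: "(\<alpha>, \<beta>) \<noteq> (0, 0)"
    and "(u $ (1, 1) * u $ (2, 2) - u $ (1, 2) * u $ (2, 1)) * \<alpha>\<^sup>2
      + (u $ (1, 1) * v $ (2, 2) + v $ (1, 1) * u $ (2, 2)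
         - u $ (1, 2) * v $ (2, 1) - v $ (1, 2) * u $ (2, 1)) * \<alpha> * \<beta>
      + (v $ (1, 1) * v $ (2, 2) - v $ (1, 2) * v $ (2, 1)) * \<beta>\<^sup>2 = 0"
    by (rule complex_quadratic_form_zero)
  then have "(\<alpha> *s u + \<beta> *s v) $ (1, 1) * (\<alpha> *s u + \<beta> *s v) $ (2, 2)
      = (\<alpha> *s u + \<beta> *s v) $ (1, 2) * (\<alpha> *s u + \<beta> *s v) $ (2, 1)"
    by (simp add: algebra_simps power2_eq_square)
  then show thesis using ab that by (metis tensor_vec_of_det_zero)
qed

lemma klein_entropy_product_le_1:
  fixes M :: "two_qubit_op set"
  assumes "von_neumann_measurement M"
  obtains \<delta> where "\<delta> \<in> product_states" "klein_entropy \<delta> M \<le> 1"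
proof -
  obtain f where f: "onb f" "M = range (\<lambda>i. outer (f i))"
    using von_neumann_measurement_imp_onb[OF assms] by metis
  \<comment> \<open>Two distinct indices, chosen arbitrarily: the product vector is sought in the
    plane of these two basis vectors.\<close>
  let ?i = "(1, 1) :: 2 \<times> 2" and ?j = "(1, 2) :: 2 \<times> 2"
  obtain \<alpha> \<beta> x y where ab: "(\<alpha>, \<beta>) \<noteq> (0, 0)" and w: "\<alpha> *s f ?i + \<beta> *s f ?j = tensor_vec x y"
    by (rule product_vector_in_plane)
  have w_coord: "cinner (f k) (tensor_vec x y) = (if k = ?i then \<alpha> else if k = ?j then \<beta> else 0)" for k
    using f(1)[unfolded onb_def, rule_format, of k ?i] f(1)[unfolded onb_def, rule_format, of k ?j]
    by (auto simp: cinner_add_right cinner_scale_right simp flip: w)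
  have "tensor_vec x y \<noteq> 0" using w_coord[of ?i] w_coord[of ?j] ab by auto
  then have xy: "x \<noteq> 0" "y \<noteq> 0" by (auto simp: tensor_vec_def vec_eq_iff)
  define x' where "x' = of_real (1 / norm x) *s x"
  define y' where "y' = of_real (1 / norm y) *s y"
  have unit: "cinner x' x' = 1" "cinner y' y' = 1"
    unfolding x'_def y'_def by (rule cinner_normalized[OF xy(1)], rule cinner_normalized[OF xy(2)])
  define \<delta> where "\<delta> = tensor_op (outer x') (outer y')"
  have \<delta>: "\<delta> \<in> product_states"
    unfolding product_states_def \<delta>_def using state_outer[OF unit(1)] state_outer[OF unit(2)] by blast
  have st: "state \<delta>"
    unfolding \<delta>_def by (intro state_tensor_op state_outer unit)
  define p where "p k = Re (cinner (f k) (\<delta> *v f k))" for k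
  have "tensor_vec x' y' = of_real (1 / norm x * (1 / norm y)) *s tensor_vec x y"
    by (simp add: x'_def y'_def tensor_vec_def vec_eq_iff mult_ac)
  \<comment> \<open>Normalizing the factors only rescales the product vector, so the outcomes
    outside the plane keep probability zero.\<close>
  then have "p k = (cmod (of_real (1 / norm x * (1 / norm y)) * cinner (f k) (tensor_vec x y)))\<^sup>2" for k
    unfolding p_def \<delta>_def tensor_op_outer cinner_outer
    by (metis Re_complex_of_real cinner_scale_right cnj_cinner complex_mod_cnj)
  then have p0: "p k = 0" if "k \<noteq> ?i" "k \<noteq> ?j" for k using that by (simp add: w_coord)
  have red: "(\<Sum>k\<in>UNIV. h (p k)) = h (p ?i) + h (p ?j)" if "h 0 = 0" for h :: "real \<Rightarrow> real"
  proof -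
    have "(\<Sum>k\<in>UNIV. h (p k)) = (\<Sum>k\<in>{?i, ?j}. h (p k))"
      by (rule sum.mono_neutral_right) (auto simp: p0 that)
    then show ?thesis by simp
  qed
  have "p ?i + p ?j = 1"
    using state_sum_onb[OF st f(1)] red[of "\<lambda>t. t"] by (simp add: p_def)
  then have "- (p ?i * log 2 (p ?i)) - p ?j * log 2 (p ?j) \<le> 1"
    using state_quadratic_nonneg[OF st] by (intro binary_entropy_le_1) (auto simp: p_def)
  then have "klein_entropy \<delta> M \<le> 1"
    using red[of "\<lambda>t. t * log 2 t"] by (simp add: f(2) klein_entropy_onb[OF f(1)] p_def)
  with \<delta> show thesis by (rule that)
qed

lemma INF_klein_entropy_le_1:
  fixes M :: "two_qubit_op set"
  assumes M: "von_neumann_measurement M"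
  shows "(INF \<delta>\<in>product_states. klein_entropy \<delta> M) \<le> 1"
proof -
  obtain \<delta> where \<delta>: "\<delta> \<in> product_states" "klein_entropy \<delta> M \<le> 1"
    using klein_entropy_product_le_1[OF M] .
  have "bdd_below ((\<lambda>\<delta>. klein_entropy \<delta> M) ` product_states)"
    by (rule bdd_belowI2[of _ 0])
       (auto simp: product_states_def intro!: klein_entropy_nonneg state_tensor_op M)
  then show ?thesis using \<delta> by (meson cINF_lower order_trans)
qed

theorem mainTheorem8:
  fixes \<rho>B :: two_qubit_op and S :: "two_qubit_vec set"
  assumes "state \<rho>B"
    and "maximally_entangled_basis S"
    and "diagonal_in S \<rho>B"
  shows "entropic_entanglement \<rho>B = 1 - von_neumann_entropy \<rho>B"
proof -
  obtain g where g: "onb g" "S = range g"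
    using assms(2) orthonormal_basis_imp_onb by (metis maximally_entangled_basis_def)
  have me: "maximally_entangled (g i)" for i
    using assms(2) g(2) by (simp add: maximally_entangled_basis_def del: split_paired_All)
  have diag: "diagonal_in (range g) \<rho>B" using assms(3) g(2) by simp
  define M where "M = range (\<lambda>i. outer (g i))"
  have M: "von_neumann_measurement M"
    unfolding M_def by (rule von_neumann_measurement_onb[OF g(1)])
  \<comment> \<open>A lower bound of all members bounds the infimum from below only for a nonempty
    set.\<close>
  have "product_states \<noteq> {}" using klein_entropy_product_le_1[OF M] by blast
  then have "1 \<le> (INF \<delta>\<in>product_states. klein_entropy \<delta> M)"
    unfolding M_def by (intro cINF_greatest klein_entropy_product_ge_1 g(1) me)
  then have "(INF \<delta>\<in>product_states. klein_entropy \<delta> M) = 1"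
    using INF_klein_entropy_le_1[OF M] by linarith
  moreover have "klein_entropy \<rho>B M = von_neumann_entropy \<rho>B"
    unfolding M_def klein_entropy_onb[OF g(1)] von_neumann_entropy_onb[OF assms(1) g(1) diag] ..
  ultimately have attained: "1 - von_neumann_entropy \<rho>B
      = (INF \<delta>\<in>product_states. klein_entropy \<delta> M) - klein_entropy \<rho>B M" by simp
  show ?thesis
    unfolding entropic_entanglement_def
  \<comment> \<open>The value is attained at the measurement \<open>M\<close> in the entangled
    basis, so the supremum is a maximum: membership and the upper bound determine it.\<close>
  proof (rule cSup_eq_maximum)
    show "1 - von_neumann_entropy \<rho>B
        \<in> (\<lambda>M. (INF \<delta>\<in>product_states. klein_entropy \<delta> M) - klein_entropy \<rho>B M)
            ` {M. von_neumann_measurement M}"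
      unfolding attained using M by blast
  next
    fix z
    assume "z \<in> (\<lambda>M. (INF \<delta>\<in>product_states. klein_entropy \<delta> M) - klein_entropy \<rho>B M)
            ` {M. von_neumann_measurement M}"
    then obtain N where N: "von_neumann_measurement N"
      and z: "z = (INF \<delta>\<in>product_states. klein_entropy \<delta> N) - klein_entropy \<rho>B N" by auto
    show "z \<le> 1 - von_neumann_entropy \<rho>B"
      unfolding z using INF_klein_entropy_le_1[OF N]
        von_neumann_entropy_le_klein_entropy[OF assms(1) g(1) diag N] by (rule diff_mono)
  qed
qed

end
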